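(* Let $p:\mathcal{A}\to X$ be a (surjective) fibration. Suppose that $X=K\cup_\alpha CS$ is the mapping cone of a map $\alpha:S\to K$. Then $$\mathrm{secat}_K(p)\le\mathrm{secat}(p)\le\mathrm{secat}_K(p)+1.$$
   Context: Spaces are well-pointed, compactly generated, of the homotopy type of CW-complexes; maps and fibrations are pointed. $CS=S\times I/S\times1$. For a surjective fibration $p:\mathcal{A}\to X$, $\mathrm{secat}(p)$ is the least integer $n\ge0$ such that $X$ has a cover by $n+1$ open sets on each of which there is a continuous (not necessarily pointed) local section of $p$ ($\infty$ if none exists). For a map $\varphi:K\to X$, $\mathrm{secat}_\varphi(p)$ is the sectional category of the pullback fibration $\varphi^*p$ over $K$; $\mathrm{secat}_K(p)$ denotes this for the inclusion $K\hookrightarrow X$. *)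

theory Defs
  imports "HOL-Analysis.Analysis" "HOL-Library.Extended_Nat"
begin

section \<open>Quotients, disjoint unions and mapping cones\<close>

abbreviation unit_interval :: "real topology" where
  "unit_interval \<equiv> top_of_set {0..1}"

text \<open>The finest topology on the image of \<open>q\<close> for which \<open>q\<close> is continuous.\<close>

definition image_topology :: "'a topology \<Rightarrow> ('a \<Rightarrow> 'b) \<Rightarrow> 'b topology" where
  "image_topology X q =
     topology (\<lambda>U. U \<subseteq> q ` topspace X \<and> openin X {x \<in> topspace X. q x \<in> U})"

lemma openin_image_topology:
  "openin (image_topology X q) U \<longleftrightarrow>
     U \<subseteq> q ` topspace X \<and> openin X {x \<in> topspace X. q x \<in> U}"
proof -
  have "istopology (\<lambda>U. U \<subseteq> q ` topspace X \<and> openin X {x \<in> topspace X. q x \<in> U})"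
    unfolding istopology_def
  proof (intro conjI allI impI; (elim conjE)?)
    fix S T
    assume "openin X {x \<in> topspace X. q x \<in> S}" "openin X {x \<in> topspace X. q x \<in> T}"
    moreover have "{x \<in> topspace X. q x \<in> S \<inter> T} =
      {x \<in> topspace X. q x \<in> S} \<inter> {x \<in> topspace X. q x \<in> T}" by auto
    ultimately show "openin X {x \<in> topspace X. q x \<in> S \<inter> T}" by (simp add: openin_Int)
  next
    fix \<K>
    assume *: "\<forall>U\<in>\<K>. U \<subseteq> q ` topspace X \<and> openin X {x \<in> topspace X. q x \<in> U}"
    have "{x \<in> topspace X. q x \<in> \<Union>\<K>} = (\<Union>U\<in>\<K>. {x \<in> topspace X. q x \<in> U})" by auto
    then show "openin X {x \<in> topspace X. q x \<in> \<Union>\<K>}" using * by auto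
    show "\<Union>\<K> \<subseteq> q ` topspace X" using * by blast
  qed blast
  then show ?thesis
    unfolding image_topology_def by (simp add: topology_inverse')
qed

lemma topspace_image_topology [simp]: "topspace (image_topology X q) = q ` topspace X"
proof
  have "{x \<in> topspace X. q x \<in> q ` topspace X} = topspace X" by auto
  then have "openin (image_topology X q) (q ` topspace X)"
    by (simp add: openin_image_topology)
  then show "q ` topspace X \<subseteq> topspace (image_topology X q)"
    by (rule openin_subset)
  show "topspace (image_topology X q) \<subseteq> q ` topspace X"
    using openin_image_topology[of X q] openin_topspace by blast
qed

lemma quotient_map_image_topology: "quotient_map X (image_topology X q) q"
  unfolding quotient_map_def by (auto simp: openin_image_topology)

text \<open>The quotient of a space by the equivalence relation generated by \<open>R\<close>.\<close>

definition quotient_class :: "('a \<times> 'a) set \<Rightarrow> 'a \<Rightarrow> 'a set" where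
  "quotient_class R x = {y. (x, y) \<in> (R \<union> R\<inverse>)\<^sup>*}"

definition quotient_topology :: "'a topology \<Rightarrow> ('a \<times> 'a) set \<Rightarrow> 'a set topology" where
  "quotient_topology X R = image_topology X (quotient_class R)"

definition disjoint_sum :: "'a topology \<Rightarrow> 'b topology \<Rightarrow> ('a + 'b) topology" where
  "disjoint_sum X Y =
     topology (\<lambda>U. openin X (Inl -` U) \<and> openin Y (Inr -` U))"

lemma openin_disjoint_sum:
  "openin (disjoint_sum X Y) U \<longleftrightarrow> openin X (Inl -` U) \<and> openin Y (Inr -` U)"
proof -
  have "istopology (\<lambda>U. openin X (Inl -` U) \<and> openin Y (Inr -` U))"
    unfolding istopology_def
  proof (intro conjI allI impI; (elim conjE)?)
    fix \<K>
    assume "\<forall>U\<in>\<K>. openin X (Inl -` U) \<and> openin Y (Inr -` U)"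
    then show "openin X (Inl -` \<Union>\<K>)" "openin Y (Inr -` \<Union>\<K>)"
      by (auto simp: vimage_Union)
  qed (auto simp: vimage_Int openin_Int)
  then show ?thesis
    unfolding disjoint_sum_def by (simp add: topology_inverse')
qed

lemma topspace_disjoint_sum [simp]:
  "topspace (disjoint_sum X Y) = topspace X <+> topspace Y"
proof
  have "Inl -` (topspace X <+> topspace Y) = topspace X"
    "Inr -` (topspace X <+> topspace Y) = topspace Y" by auto
  then have "openin (disjoint_sum X Y) (topspace X <+> topspace Y)"
    by (simp add: openin_disjoint_sum)
  then show "topspace X <+> topspace Y \<subseteq> topspace (disjoint_sum X Y)"
    by (rule openin_subset)
  show "topspace (disjoint_sum X Y) \<subseteq> topspace X <+> topspace Y"
  proof
    fix z assume z: "z \<in> topspace (disjoint_sum X Y)"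
    have "openin X (Inl -` topspace (disjoint_sum X Y))"
      "openin Y (Inr -` topspace (disjoint_sum X Y))"
      using openin_disjoint_sum openin_topspace by blast+
    then show "z \<in> topspace X <+> topspace Y"
      using z by (cases z) (auto dest!: openin_subset)
  qed
qed

text \<open>The unreduced cone \<open>CS = S \<times> I / S \<times> 1\<close>.\<close>

definition cone_relation :: "'s topology \<Rightarrow> (('s \<times> real) \<times> ('s \<times> real)) set" where
  "cone_relation S = {((s, 1), (s', 1)) | s s'. s \<in> topspace S \<and> s' \<in> topspace S}"

definition cone :: "'s topology \<Rightarrow> ('s \<times> real) set topology" where
  "cone S = quotient_topology (prod_topology S unit_interval) (cone_relation S)"

definition cone_point :: "'s topology \<Rightarrow> 's \<Rightarrow> real \<Rightarrow> ('s \<times> real) set" where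
  "cone_point S s t = quotient_class (cone_relation S) (s, t)"

text \<open>\<open>K \<union>\<^sub>\<alpha> CS\<close>: the disjoint union of \<open>K\<close> and \<open>CS\<close> with \<open>[s, 0]\<close> identified with \<open>\<alpha> s\<close>.\<close>

definition mapping_cone_relation ::
    "'s topology \<Rightarrow> ('s \<Rightarrow> 'k) \<Rightarrow> (('k + ('s \<times> real) set) \<times> ('k + ('s \<times> real) set)) set" where
  "mapping_cone_relation S \<alpha> = {(Inr (cone_point S s 0), Inl (\<alpha> s)) | s. s \<in> topspace S}"

definition mapping_cone ::
    "'s topology \<Rightarrow> 'k topology \<Rightarrow> ('s \<Rightarrow> 'k) \<Rightarrow> ('k + ('s \<times> real) set) set topology" where
  "mapping_cone S K \<alpha> =
     quotient_topology (disjoint_sum K (cone S)) (mapping_cone_relation S \<alpha>)"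

definition mapping_cone_inclusion ::
    "'s topology \<Rightarrow> ('s \<Rightarrow> 'k) \<Rightarrow> 'k \<Rightarrow> ('k + ('s \<times> real) set) set" where
  "mapping_cone_inclusion S \<alpha> k = quotient_class (mapping_cone_relation S \<alpha>) (Inl k)"


section \<open>The category of spaces\<close>

text \<open>Compactly generated spaces in the sense of Steenrod; the library's \<open>k_space\<close> includes
  no separation axiom.\<close>

definition compactly_generated :: "'a topology \<Rightarrow> bool" where
  "compactly_generated X \<longleftrightarrow> Hausdorff_space X \<and> k_space X"

text \<open>Well-pointed: the inclusion of \<open>x0\<close> has the homotopy extension property (\<open>{x0}\<close> is closed
  in the Hausdorff spaces to which this is applied). The target spaces range over the
  topologies on one type only. This type carries the universal target
  \<open>X \<times> 0 \<union> {x0} \<times> I\<close>, so that the extension property for targets of every type follows: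
  see \<open>well_pointed_extension\<close>.\<close>

definition well_pointed :: "'a topology \<Rightarrow> 'a \<Rightarrow> bool" where
  "well_pointed X x0 \<longleftrightarrow> x0 \<in> topspace X \<and>
     (\<forall>(Y :: ('a \<times> real) topology) f \<gamma>.
        continuous_map X Y f \<and> continuous_map unit_interval Y \<gamma> \<and> \<gamma> 0 = f x0 \<longrightarrow>
        (\<exists>H. continuous_map (prod_topology X unit_interval) Y H \<and>
             (\<forall>x\<in>topspace X. H (x, 0) = f x) \<and> (\<forall>t\<in>{0..1}. H (x0, t) = \<gamma> t)))"

lemma well_pointed_extension:
  fixes X :: "'a topology" and Y :: "'y topology"
  assumes X: "well_pointed X x0"
    and f: "continuous_map X Y f" and \<gamma>: "continuous_map unit_interval Y \<gamma>"
    and eq: "\<gamma> 0 = f x0"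
  shows "\<exists>H. continuous_map (prod_topology X unit_interval) Y H \<and>
             (\<forall>x\<in>topspace X. H (x, 0) = f x) \<and> (\<forall>t\<in>{0..1}. H (x0, t) = \<gamma> t)"
proof -
  define q :: "'a + real \<Rightarrow> 'a \<times> real"
    where "q = case_sum (\<lambda>x. (x, 0)) (\<lambda>t. (x0, t))"
  define M where "M = image_topology (disjoint_sum X unit_interval) q"
  have x0: "x0 \<in> topspace X" using X by (simp add: well_pointed_def)
  have qM: "quotient_map (disjoint_sum X unit_interval) M q"
    unfolding M_def by (rule quotient_map_image_topology)
  have inl: "continuous_map X (disjoint_sum X unit_interval) Inl"
    unfolding continuous_map_def
  proof (intro conjI allI impI funcsetI)
    fix U assume U: "openin (disjoint_sum X unit_interval) U"
    then have "{x \<in> topspace X. Inl x \<in> U} = Inl -` U"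
      by (auto dest: openin_subset simp: openin_disjoint_sum)
    then show "openin X {x \<in> topspace X. Inl x \<in> U}" using U by (simp add: openin_disjoint_sum)
  qed auto
  have inr: "continuous_map unit_interval (disjoint_sum X unit_interval) Inr"
    unfolding continuous_map_def
  proof (intro conjI allI impI funcsetI)
    fix U assume U: "openin (disjoint_sum X unit_interval) U"
    then have "{t \<in> topspace unit_interval. Inr t \<in> U} = Inr -` U"
      unfolding openin_disjoint_sum by (metis (no_types, lifting) Collect_cong Collect_mem_eq openin_subset subsetD vimage_eq)
    then show "openin unit_interval {t \<in> topspace unit_interval. Inr t \<in> U}"
      using U by (simp add: openin_disjoint_sum)
  qed auto
  have f': "continuous_map X M (\<lambda>x. (x, 0))"
    using continuous_map_compose[OF inl quotient_imp_continuous_map[OF qM]]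
    by (simp add: o_def q_def)
  have \<gamma>': "continuous_map unit_interval M (\<lambda>t. (x0, t))"
    using continuous_map_compose[OF inr quotient_imp_continuous_map[OF qM]]
    by (simp add: o_def q_def)
  obtain H where H: "continuous_map (prod_topology X unit_interval) M H"
    "\<forall>x\<in>topspace X. H (x, 0) = (x, 0)" "\<forall>t\<in>{0..1}. H (x0, t) = (x0, t)"
    using X[unfolded well_pointed_def, THEN conjunct2, THEN spec[of _ M],
        THEN spec[of _ "\<lambda>x. (x, 0)"], THEN spec[of _ "\<lambda>t. (x0, t)"]] f' \<gamma>' by auto
  define g where "g = (\<lambda>(x, t). if t = 0 then f x else \<gamma> t)"
  have gq: "g \<circ> q = case_sum f \<gamma>"
    using eq by (auto simp: g_def q_def fun_eq_iff split: sum.split)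
  have "continuous_map (disjoint_sum X unit_interval) Y (case_sum f \<gamma>)"
    unfolding continuous_map_def
  proof (intro conjI allI impI funcsetI)
    fix z assume "z \<in> topspace (disjoint_sum X unit_interval)"
    then show "case_sum f \<gamma> z \<in> topspace Y"
      using f \<gamma> by (auto simp: continuous_map_def)
  next
    fix U assume U: "openin Y U"
    let ?V = "{z \<in> topspace (disjoint_sum X unit_interval). case_sum f \<gamma> z \<in> U}"
    have "Inl -` ?V = {x \<in> topspace X. f x \<in> U}"
      "Inr -` ?V = {t \<in> topspace unit_interval. \<gamma> t \<in> U}" by auto
    then show "openin (disjoint_sum X unit_interval) ?V"
      using U openin_continuous_map_preimage[OF f U] openin_continuous_map_preimage[OF \<gamma> U]
      by (simp add: openin_disjoint_sum)
  qed
  then have "continuous_map M Y g"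
    using continuous_compose_quotient_map[OF qM] gq by metis
  then have "continuous_map (prod_topology X unit_interval) Y (g \<circ> H)"
    using H(1) continuous_map_compose by blast
  moreover have "\<forall>x\<in>topspace X. (g \<circ> H) (x, 0) = f x" using H(2) by (simp add: g_def)
  moreover have "\<forall>t\<in>{0..1}. (g \<circ> H) (x0, t) = \<gamma> t" using H(3) eq by (simp add: g_def)
  ultimately show ?thesis by blast
qed

definition closed_disc :: "nat \<Rightarrow> (nat \<Rightarrow> real) topology" where
  "closed_disc n = subtopology (Euclidean_space n) {x. (\<Sum>i<n. (x i)\<^sup>2) \<le> 1}"

definition open_disc :: "nat \<Rightarrow> (nat \<Rightarrow> real) topology" where
  "open_disc n = subtopology (Euclidean_space n) {x. (\<Sum>i<n. (x i)\<^sup>2) < 1}"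

definition disc_boundary :: "nat \<Rightarrow> (nat \<Rightarrow> real) set" where
  "disc_boundary n = topspace (closed_disc n) - topspace (open_disc n)"

text \<open>Whitehead's definition: \<open>Z\<close> is partitioned into the open cells \<open>e \<in> E\<close>, of dimension \<open>d e\<close>
  and with characteristic map \<open>\<Phi> e\<close>; the last two conditions are closure-finiteness and the weak
  topology.\<close>

definition CW_complex :: "'a topology \<Rightarrow> bool" where
  "CW_complex Z \<longleftrightarrow> Hausdorff_space Z \<and>
     (\<exists>(E :: 'a set set) (d :: 'a set \<Rightarrow> nat) (\<Phi> :: 'a set \<Rightarrow> (nat \<Rightarrow> real) \<Rightarrow> 'a).
        disjoint E \<and> \<Union>E = topspace Z \<and>
        (\<forall>e\<in>E. continuous_map (closed_disc (d e)) Z (\<Phi> e) \<and>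
                homeomorphic_map (open_disc (d e)) (subtopology Z e) (\<Phi> e)) \<and>
        (\<forall>e\<in>E. \<exists>F. finite F \<and> F \<subseteq> {e' \<in> E. d e' < d e} \<and> \<Phi> e ` disc_boundary (d e) \<subseteq> \<Union>F) \<and>
        (\<forall>C. C \<subseteq> topspace Z \<and> (\<forall>e\<in>E. closedin Z (C \<inter> (Z closure_of e))) \<longrightarrow> closedin Z C))"

text \<open>A space of the homotopy type of a CW complex is homotopy equivalent to the geometric
  realization of its singular complex, whose points are pairs of a nondegenerate singular simplex
  and an interior point of the corresponding standard simplex. Hence it is no restriction to look
  for the CW complex on the type used here.\<close>

definition has_CW_homotopy_type :: "'a topology \<Rightarrow> bool" where
  "has_CW_homotopy_type X \<longleftrightarrow>
     (\<exists>Z :: (((nat \<Rightarrow> real) \<Rightarrow> 'a) \<times> (nat \<Rightarrow> real)) topology.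
        CW_complex Z \<and> X homotopy_equivalent_space Z)"

definition pointed_space :: "'a topology \<Rightarrow> 'a \<Rightarrow> bool" where
  "pointed_space X x0 \<longleftrightarrow>
     well_pointed X x0 \<and> compactly_generated X \<and> has_CW_homotopy_type X"


section \<open>Fibrations and sectional category\<close>

text \<open>Homotopy lifting property with respect to compactly generated spaces. The test spaces range
  over the topologies on one type only, which is large enough for the lifting property to follow
  for test spaces of every type: see \<open>fibration_lift\<close>.\<close>

definition fibration :: "'a topology \<Rightarrow> 'x topology \<Rightarrow> ('a \<Rightarrow> 'x) \<Rightarrow> bool" where
  "fibration A X p \<longleftrightarrow> continuous_map A X p \<and>
     (\<forall>(Y :: ('a \<times> (real \<Rightarrow> 'x)) topology) f H.
        compactly_generated Y \<and> continuous_map Y A f \<and>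
        continuous_map (prod_topology Y unit_interval) X H \<and>
        (\<forall>y\<in>topspace Y. H (y, 0) = p (f y)) \<longrightarrow>
        (\<exists>G. continuous_map (prod_topology Y unit_interval) A G \<and>
             (\<forall>y\<in>topspace Y. G (y, 0) = f y) \<and>
             (\<forall>y\<in>topspace Y. \<forall>t\<in>{0..1}. p (G (y, t)) = H (y, t))))"

lemma fibration_lift:
  fixes A :: "'a topology" and X :: "'x topology" and Y :: "'y topology"
  assumes p: "fibration A X p" and A: "Hausdorff_space A" and X: "Hausdorff_space X"
    and Y: "compactly_generated Y" and f: "continuous_map Y A f"
    and H: "continuous_map (prod_topology Y unit_interval) X H"
    and H0: "\<forall>y\<in>topspace Y. H (y, 0) = p (f y)"
  shows "\<exists>G. continuous_map (prod_topology Y unit_interval) A G \<and>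
             (\<forall>y\<in>topspace Y. G (y, 0) = f y) \<and>
             (\<forall>y\<in>topspace Y. \<forall>t\<in>{0..1}. p (G (y, t)) = H (y, t))"
proof -
  define q where "q = (\<lambda>y. (f y, \<lambda>t. if t \<in> {0..1} then H (y, t) else undefined))"
  define W where "W = image_topology Y q"
  define ev :: "('a \<times> (real \<Rightarrow> 'x)) \<times> real \<Rightarrow> 'x" where "ev = (\<lambda>(w, t). snd w t)"
  have qW: "quotient_map Y W q"
    unfolding W_def by (rule quotient_map_image_topology)
  have tW: "topspace W = q ` topspace Y" by (simp add: W_def)
  have "locally_compact_space unit_interval"
    by (simp add: compact_imp_locally_compact_space compact_space_subtopology)
  moreover have HI: "Hausdorff_space unit_interval"
    by (simp add: Hausdorff_space_subtopology)
  ultimately have qI: "quotient_map (prod_topology Y unit_interval) (prod_topology W unit_interval)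
      (\<lambda>(y, t). (q y, t))"
    using qW quotient_map_prod_left by blast
  have fW: "continuous_map W A fst"
    using continuous_compose_quotient_map[OF qW, of A fst] f by (simp add: o_def q_def)
  have "continuous_map (prod_topology Y unit_interval) X (ev \<circ> (\<lambda>(y, t). (q y, t)))"
    by (rule continuous_map_eq[OF H]) (auto simp: ev_def q_def)
  then have evW: "continuous_map (prod_topology W unit_interval) X ev"
    using continuous_compose_quotient_map[OF qI] by blast
  have evt: "continuous_map W X (\<lambda>w. snd w t)" if "t \<in> {0..1}" for t
  proof -
    have "continuous_map W (prod_topology W unit_interval) (\<lambda>w. (w, t))"
      using that by (simp add: continuous_map_pairwise o_def)
    from continuous_map_compose[OF this evW] show ?thesis by (simp add: o_def ev_def)
  qed
  have sep: "\<exists>U V. openin W U \<and> openin W V \<and> w \<in> U \<and> w' \<in> V \<and> disjnt U V"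
    if h: "continuous_map W B h" and B: "Hausdorff_space B"
      and w: "w \<in> topspace W" "w' \<in> topspace W" and ne: "h w \<noteq> h w'"
    for B :: "'b topology" and h w w'
  proof -
    have "h w \<in> topspace B" "h w' \<in> topspace B"
      using h w by (auto simp: continuous_map_def)
    then obtain U V where UV: "openin B U" "openin B V" "h w \<in> U" "h w' \<in> V" "disjnt U V"
      using B ne unfolding Hausdorff_space_def by metis
    show ?thesis
    proof (intro exI conjI)
      show "openin W {z \<in> topspace W. h z \<in> U}" "openin W {z \<in> topspace W. h z \<in> V}"
        using UV h openin_continuous_map_preimage by blast+
    qed (use UV w in \<open>auto simp: disjnt_def\<close>)
  qed
  have "Hausdorff_space W"
    unfolding Hausdorff_space_def
  proof (intro allI impI, elim conjE)
    fix w w' assume w: "w \<in> topspace W" "w' \<in> topspace W" and ne: "w \<noteq> w'"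
    show "\<exists>U V. openin W U \<and> openin W V \<and> w \<in> U \<and> w' \<in> V \<and> disjnt U V"
    proof (cases "fst w = fst w'")
      case False
      then show ?thesis using sep[OF fW A w] by simp
    next
      case True
      then obtain t where t: "snd w t \<noteq> snd w' t"
        using ne by (metis ext prod_eqI)
      then have "t \<in> {0..1}" using w by (auto simp: tW q_def split: if_splits)
      then show ?thesis using sep[OF evt X w t] by simp
    qed
  qed
  moreover have "k_space W"
    using k_space_quotient_map_image[OF qW] Y by (simp add: compactly_generated_def)
  ultimately have cg: "compactly_generated W" by (simp add: compactly_generated_def)
  have ev0: "\<forall>w\<in>topspace W. ev (w, 0) = p (fst w)"
    using H0 by (auto simp: tW ev_def q_def)
  obtain G where G: "continuous_map (prod_topology W unit_interval) A G"
    "\<forall>w\<in>topspace W. G (w, 0) = fst w"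
    "\<forall>w\<in>topspace W. \<forall>t\<in>{0..1}. p (G (w, t)) = ev (w, t)"
    using p[unfolded fibration_def, THEN conjunct2, THEN spec[of _ W], THEN spec[of _ fst],
        THEN spec[of _ ev]] cg fW evW ev0 by auto
  show ?thesis
  proof (intro exI conjI)
    show "continuous_map (prod_topology Y unit_interval) A (G \<circ> (\<lambda>(y, t). (q y, t)))"
      using continuous_map_compose[OF quotient_imp_continuous_map[OF qI] G(1)] .
  qed (use G in \<open>auto simp: tW ev_def q_def\<close>)
qed

text \<open>The pullback in compactly generated spaces: \<open>K \<times>\<^sub>X A\<close> with the \<open>k\<close>-ification of the subspace
  topology, the projection to \<open>K\<close> being \<open>fst\<close>.\<close>

definition pullback_space ::
    "'k topology \<Rightarrow> 'a topology \<Rightarrow> ('k \<Rightarrow> 'x) \<Rightarrow> ('a \<Rightarrow> 'x) \<Rightarrow> ('k \<times> 'a) topology" where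
  "pullback_space K A \<phi> p =
     kification (subtopology (prod_topology K A) {(k, a). \<phi> k = p a})"

definition has_local_section ::
    "'a topology \<Rightarrow> 'x topology \<Rightarrow> ('a \<Rightarrow> 'x) \<Rightarrow> 'x set \<Rightarrow> bool" where
  "has_local_section A X p U \<longleftrightarrow>
     (\<exists>s. continuous_map (subtopology X U) A s \<and> (\<forall>x\<in>U. p (s x) = x))"

text \<open>The infimum of the empty set in \<^typ>\<open>enat\<close> is \<open>\<infinity>\<close>.\<close>

definition secat :: "'a topology \<Rightarrow> 'x topology \<Rightarrow> ('a \<Rightarrow> 'x) \<Rightarrow> enat" where
  "secat A X p =
     Inf {enat n | n. \<exists>U :: nat \<Rightarrow> 'x set.
            (\<forall>i\<le>n. openin X (U i) \<and> has_local_section A X p (U i)) \<and>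
            (\<Union>i\<le>n. U i) = topspace X}"

definition secat_along ::
    "'k topology \<Rightarrow> ('k \<Rightarrow> 'x) \<Rightarrow> 'a topology \<Rightarrow> ('a \<Rightarrow> 'x) \<Rightarrow> enat" where
  "secat_along K \<phi> A p = secat (pullback_space K A \<phi> p) K fst"

end

theory Submission
  imports Defs
begin

text \<open>
  Pulling back along \<open>K \<rightarrow> X\<close> turns local sections over open sets \<open>U\<^sub>i\<close> into local sections over
  their preimages, which gives the first inequality. For the second, a homotopy into \<open>X\<close> from a map that
  factors through \<open>p\<close> to the inclusion of an open set lifts to \<open>A\<close> and ends in a local section.
  If \<open>V \<subseteq> K\<close> carries a local section, then this applies to the open set of all points of \<open>V\<close> together
  with all \<open>[s, t]\<close> such that \<open>\<alpha> s \<in> V\<close> and \<open>t < 1\<close>, which deforms onto \<open>V\<close> along the lines of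
  the cone. These sets cover the image of \<open>K\<close>, and one more open set,
  \<open>{[s, t] | t > 0}\<close>, contracts to the apex and covers the rest.
\<close>

section \<open>Maps out of the mapping cone\<close>

lemma quotient_class_eq:
  assumes "(x, y) \<in> R"
  shows "quotient_class R x = quotient_class R y"
proof -
  let ?E = "(R \<union> R\<inverse>)\<^sup>*"
  have "(x, y) \<in> ?E" "(y, x) \<in> ?E" using assms by auto
  then show ?thesis unfolding quotient_class_def by (auto intro: rtrancl_trans)
qed

text \<open>Two points of one class are joined by a chain of steps in \<open>R\<close> and its
  converse, and \<open>f\<close> is constant along each step. Hence evaluating \<open>f\<close> at a
  chosen representative does not depend on the choice.\<close>

lemma quotient_class_lift:
  assumes "\<And>x y. (x, y) \<in> R \<Longrightarrow> f x = f y"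
  obtains g where "\<And>x. g (quotient_class R x) = f x"
proof -
  have *: "f x = f y" if "quotient_class R x = quotient_class R y" for x y
  proof -
    have "(x, y) \<in> (R \<union> R\<inverse>)\<^sup>*" using that unfolding quotient_class_def by auto
    then show ?thesis by (induction rule: rtrancl_induct) (use assms in force)+
  qed
  show ?thesis
  proof
    show "f (SOME y. quotient_class R y = quotient_class R x) = f x" for x
      by (rule *, rule someI_ex) blast
  qed
qed

text \<open>Collapsing \<open>S \<times> 1\<close> and gluing the base happen in one map, so that
  points of the mapping cone are named by points of \<open>K\<close> and pairs
  \<open>(s, t)\<close>, without the intermediate classes of \<open>cone S\<close>.\<close>

definition mapping_cone_proj ::
    "'s topology \<Rightarrow> ('s \<Rightarrow> 'k) \<Rightarrow> 'k + 's \<times> real \<Rightarrow> ('k + ('s \<times> real) set) set" where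
  "mapping_cone_proj S \<alpha> = quotient_class (mapping_cone_relation S \<alpha>) \<circ>
     map_sum id (quotient_class (cone_relation S))"

lemma mapping_cone_proj_Inl: "mapping_cone_proj S \<alpha> (Inl k) = mapping_cone_inclusion S \<alpha> k"
  by (simp add: mapping_cone_proj_def mapping_cone_inclusion_def)

lemma mapping_cone_proj_base:
  assumes "s \<in> topspace S"
  shows "mapping_cone_proj S \<alpha> (Inr (s, 0)) = mapping_cone_inclusion S \<alpha> (\<alpha> s)"
  unfolding mapping_cone_proj_def mapping_cone_inclusion_def o_apply
  by (rule quotient_class_eq) (use assms in \<open>auto simp: mapping_cone_relation_def cone_point_def\<close>)

lemma mapping_cone_proj_apex:
  assumes "s \<in> topspace S" "s' \<in> topspace S"
  shows "mapping_cone_proj S \<alpha> (Inr (s, 1)) = mapping_cone_proj S \<alpha> (Inr (s', 1))"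
proof -
  have "quotient_class (cone_relation S) (s, 1) = quotient_class (cone_relation S) (s', 1)"
    by (rule quotient_class_eq) (use assms in \<open>auto simp: cone_relation_def\<close>)
  then show ?thesis by (simp add: mapping_cone_proj_def)
qed

text \<open>The universal property for bare functions. It carries no topology because it also serves
  to define functions that are continuous only over an open set and take a default value
  elsewhere.\<close>

lemma mapping_cone_lift:
  assumes base: "\<And>s. s \<in> topspace S \<Longrightarrow> g (s, 0) = h (\<alpha> s)"
    and apex: "\<And>s s'. \<lbrakk>s \<in> topspace S; s' \<in> topspace S\<rbrakk> \<Longrightarrow> g (s, 1) = g (s', 1)"
  obtains f where "\<And>d. f (mapping_cone_proj S \<alpha> d) = case_sum h g d"
proof -
  obtain g' where g': "\<And>z. g' (quotient_class (cone_relation S) z) = g z"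
    by (rule quotient_class_lift[of "cone_relation S" g])
       (use apex in \<open>auto simp: cone_relation_def\<close>)
  obtain f where f: "\<And>z. f (quotient_class (mapping_cone_relation S \<alpha>) z) = case_sum h g' z"
    by (rule quotient_class_lift[of "mapping_cone_relation S \<alpha>" "case_sum h g'"])
       (use base in \<open>auto simp: mapping_cone_relation_def cone_point_def g'\<close>)
  show ?thesis
    by (rule that[of f]) (auto simp: mapping_cone_proj_def f g' split: sum.split)
qed

section \<open>The mapping cone as a topological quotient of the disjoint sum of \<open>K\<close>
  and \<open>S \<times> I\<close>\<close>

lemma quotient_map_disjoint_sum_right:
  assumes "quotient_map Y Z f"
  shows "quotient_map (disjoint_sum X Y) (disjoint_sum X Z) (map_sum id f)"
  unfolding quotient_map_def
proof (intro conjI allI impI)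
  have im: "f ` topspace Y = topspace Z" using assms by (simp add: quotient_map_def)
  then show "map_sum id f ` topspace (disjoint_sum X Y) = topspace (disjoint_sum X Z)"
    by (force simp: Plus_def)
  fix U assume U: "U \<subseteq> topspace (disjoint_sum X Z)"
  let ?P = "{x \<in> topspace (disjoint_sum X Y). map_sum id f x \<in> U}"
  have "Inl -` ?P = Inl -` U" "Inr -` ?P = {y \<in> topspace Y. f y \<in> Inr -` U}"
    using U by auto
  moreover have "Inr -` U \<subseteq> topspace Z" using U by auto
  ultimately show "openin (disjoint_sum X Y) ?P = openin (disjoint_sum X Z) U"
    using assms by (auto simp: openin_disjoint_sum quotient_map_def)
qed

lemma quotient_map_mapping_cone_proj:
  "quotient_map (disjoint_sum K (prod_topology S unit_interval)) (mapping_cone S K \<alpha>)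
     (mapping_cone_proj S \<alpha>)"
  unfolding mapping_cone_proj_def mapping_cone_def quotient_topology_def cone_def
  by (rule quotient_map_compose[OF quotient_map_disjoint_sum_right[OF quotient_map_image_topology]
        quotient_map_image_topology])

lemma continuous_map_case_sum:
  assumes f: "continuous_map X Z f" and g: "continuous_map Y Z g"
  shows "continuous_map (disjoint_sum X Y) Z (case_sum f g)"
  unfolding continuous_map_def
proof (intro conjI allI impI funcsetI)
  fix d assume "d \<in> topspace (disjoint_sum X Y)"
  then show "case_sum f g d \<in> topspace Z" using f g by (auto simp: continuous_map_def)
next
  fix U assume U: "openin Z U"
  let ?P = "{d \<in> topspace (disjoint_sum X Y). case_sum f g d \<in> U}"
  have "Inl -` ?P = {x \<in> topspace X. f x \<in> U}" "Inr -` ?P = {y \<in> topspace Y. g y \<in> U}" by auto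
  then show "openin (disjoint_sum X Y) ?P"
    using openin_continuous_map_preimage[OF f U] openin_continuous_map_preimage[OF g U]
    by (simp add: openin_disjoint_sum)
qed

text \<open>Each summand is open in the disjoint sum, so an open box in \<open>X \<times> Z\<close>
  or \<open>Y \<times> Z\<close> stays an open box in the product with the sum.\<close>

lemma continuous_map_disjoint_sum_prod:
  assumes inl: "continuous_map (prod_topology X Z) T (\<lambda>(x, z). F (Inl x, z))"
    and inr: "continuous_map (prod_topology Y Z) T (\<lambda>(y, z). F (Inr y, z))"
  shows "continuous_map (prod_topology (disjoint_sum X Y) Z) T F"
  unfolding continuous_map_def
proof (intro conjI allI impI funcsetI)
  fix w assume "w \<in> topspace (prod_topology (disjoint_sum X Y) Z)"
  then show "F w \<in> topspace T"
    using inl inr by (fastforce simp: continuous_map_def Pi_iff)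
next
  fix U assume U: "openin T U"
  let ?P = "{w \<in> topspace (prod_topology (disjoint_sum X Y) Z). F w \<in> U}"
  show "openin (prod_topology (disjoint_sum X Y) Z) ?P"
    unfolding openin_prod_topology_alt
  proof (intro allI impI)
    fix d z assume dz: "(d, z) \<in> ?P"
    show "\<exists>V W. openin (disjoint_sum X Y) V \<and> openin Z W \<and> d \<in> V \<and> z \<in> W \<and> V \<times> W \<subseteq> ?P"
    proof (cases d)
      case (Inl x)
      define N where "N = {w \<in> topspace (prod_topology X Z). (\<lambda>(x, z). F (Inl x, z)) w \<in> U}"
      have "openin (prod_topology X Z) N"
        unfolding N_def by (rule openin_continuous_map_preimage[OF inl U])
      moreover have "(x, z) \<in> N" using dz Inl by (auto simp: N_def)
      ultimately obtain V W where VW: "openin X V" "openin Z W" "x \<in> V" "z \<in> W" "V \<times> W \<subseteq> N"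
        unfolding openin_prod_topology_alt by metis
      have "openin (disjoint_sum X Y) (Inl ` V)"
        using VW by (simp add: openin_disjoint_sum vimage_def image_iff)
      moreover have "Inl ` V \<times> W \<subseteq> ?P" using VW(5) by (auto simp: N_def)
      ultimately show ?thesis using VW Inl by blast
    next
      case (Inr y)
      define N where "N = {w \<in> topspace (prod_topology Y Z). (\<lambda>(y, z). F (Inr y, z)) w \<in> U}"
      have "openin (prod_topology Y Z) N"
        unfolding N_def by (rule openin_continuous_map_preimage[OF inr U])
      moreover have "(y, z) \<in> N" using dz Inr by (auto simp: N_def)
      ultimately obtain V W where VW: "openin Y V" "openin Z W" "y \<in> V" "z \<in> W" "V \<times> W \<subseteq> N"
        unfolding openin_prod_topology_alt by metis
      have "openin (disjoint_sum X Y) (Inr ` V)"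
        using VW by (simp add: openin_disjoint_sum vimage_def image_iff)
      moreover have "Inr ` V \<times> W \<subseteq> ?P" using VW(5) by (auto simp: N_def)
      ultimately show ?thesis using VW Inr by blast
    qed
  qed
qed

lemma continuous_map_Inl: "continuous_map X (disjoint_sum X Y) Inl"
  unfolding continuous_map_def
proof (intro conjI allI impI funcsetI)
  fix U assume U: "openin (disjoint_sum X Y) U"
  then have "{x \<in> topspace X. Inl x \<in> U} = Inl -` U"
    by (auto dest: openin_subset simp: openin_disjoint_sum)
  then show "openin X {x \<in> topspace X. Inl x \<in> U}" using U by (simp add: openin_disjoint_sum)
qed auto

lemma continuous_map_Inr: "continuous_map Y (disjoint_sum X Y) Inr"
  unfolding continuous_map_def
proof (intro conjI allI impI funcsetI)
  fix U assume U: "openin (disjoint_sum X Y) U"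
  then have "Inr -` U \<subseteq> topspace Y" by (auto dest: openin_subset simp: openin_disjoint_sum)
  then have "{x \<in> topspace Y. Inr x \<in> U} = Inr -` U" by auto
  then show "openin Y {x \<in> topspace Y. Inr x \<in> U}" using U by (simp add: openin_disjoint_sum)
qed auto

lemma continuous_map_mapping_cone_proj:
  "continuous_map (prod_topology S unit_interval) (mapping_cone S K \<alpha>)
     (mapping_cone_proj S \<alpha> \<circ> Inr)"
  by (rule continuous_map_compose[OF continuous_map_Inr
        quotient_imp_continuous_map[OF quotient_map_mapping_cone_proj]])

lemma continuous_map_mapping_cone_inclusion:
  "continuous_map K (mapping_cone S K \<alpha>) (mapping_cone_inclusion S \<alpha>)"
  using continuous_map_compose[OF continuous_map_Inl
        quotient_imp_continuous_map[OF quotient_map_mapping_cone_proj]]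
  by (simp add: o_def mapping_cone_proj_Inl)

lemma openin_mapping_cone:
  assumes "U \<subseteq> topspace (mapping_cone S K \<alpha>)"
  shows "openin (mapping_cone S K \<alpha>) U \<longleftrightarrow>
    openin K {k \<in> topspace K. mapping_cone_inclusion S \<alpha> k \<in> U} \<and>
    openin (prod_topology S unit_interval)
      {z \<in> topspace (prod_topology S unit_interval). mapping_cone_proj S \<alpha> (Inr z) \<in> U}"
proof -
  let ?P = "{d \<in> topspace (disjoint_sum K (prod_topology S unit_interval)).
    mapping_cone_proj S \<alpha> d \<in> U}"
  have "Inl -` ?P = {k \<in> topspace K. mapping_cone_inclusion S \<alpha> k \<in> U}"
    "Inr -` ?P = {z \<in> topspace (prod_topology S unit_interval). mapping_cone_proj S \<alpha> (Inr z) \<in> U}"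
    by (auto simp: mapping_cone_proj_Inl)
  moreover have "openin (mapping_cone S K \<alpha>) U \<longleftrightarrow>
      openin (disjoint_sum K (prod_topology S unit_interval)) ?P"
    using quotient_map_mapping_cone_proj[of K S \<alpha>] assms unfolding quotient_map_def by blast
  ultimately show ?thesis by (simp add: openin_disjoint_sum)
qed

section \<open>Local sections from homotopies\<close>

text \<open>A quotient map restricts to a quotient map over an open set, and the product with the
  interval preserves it because the interval is locally compact Hausdorff. Homotopies on
  \<open>W\<close> can thus be tested for continuity upstairs.\<close>

lemma quotient_map_restrict_prod_interval:
  assumes q: "quotient_map D X q" and W: "openin X W"
  shows "quotient_map
      (prod_topology (subtopology D {d \<in> topspace D. q d \<in> W}) unit_interval)
      (prod_topology (subtopology X W) unit_interval) (\<lambda>(d, t). (q d, t))"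
proof -
  have "locally_compact_space unit_interval"
    by (simp add: compact_imp_locally_compact_space compact_space_subtopology)
  moreover have "Hausdorff_space unit_interval" by (simp add: Hausdorff_space_subtopology)
  ultimately show ?thesis
    using quotient_map_restriction[OF q refl disjI1[OF W]] quotient_map_prod_left by blast
qed

text \<open>The homotopy starts at \<open>p \<circ> f\<close>, so it lifts to one starting at
  \<open>f\<close>; the lift ends in a section because the homotopy ends at the inclusion.
  Continuity comes from \<open>F\<close>, which lives on all of \<open>D\<close> but has to descend
  along \<open>q\<close> only over \<open>W\<close>.\<close>

lemma has_local_section_homotopy:
  assumes p: "fibration A X p" and A: "Hausdorff_space A" and X: "compactly_generated X"
    and W: "openin X W" and f: "continuous_map (subtopology X W) A f"
    and q: "quotient_map D X q" and F: "continuous_map (prod_topology D unit_interval) X F"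
    and H: "\<And>d t. \<lbrakk>d \<in> topspace D; q d \<in> W; t \<in> {0..1}\<rbrakk> \<Longrightarrow> H (q d) t = F (d, t)"
    and H0: "\<And>x. x \<in> W \<Longrightarrow> H x 0 = p (f x)" and H1: "\<And>x. x \<in> W \<Longrightarrow> H x 1 = x"
  shows "has_local_section A X p W"
proof -
  let ?W = "subtopology X W"
  have WX: "W \<subseteq> topspace X" using W by (rule openin_subset)
  \<comment> \<open>Open subspaces inherit compact generation, which makes \<open>W\<close> an
    admissible test space for the lifting property.\<close>
  have cg: "compactly_generated ?W"
    using X W unfolding compactly_generated_def
    by (simp add: Hausdorff_space_subtopology k_space_open_subtopology)
  have Hc: "continuous_map (prod_topology ?W unit_interval) X (\<lambda>(x, t). H x t)"
  proof (rule continuous_compose_quotient_map[OF quotient_map_restrict_prod_interval[OF q W]])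
    show "continuous_map (prod_topology (subtopology D {d \<in> topspace D. q d \<in> W}) unit_interval)
       X ((\<lambda>(x, t). H x t) \<circ> (\<lambda>(d, t). (q d, t)))"
      unfolding prod_topology_subtopology(1)[of D]
      by (rule continuous_map_eq[OF continuous_map_from_subtopology[OF F]]) (use H in auto)
  qed
  have H0': "\<forall>y\<in>topspace ?W. (\<lambda>(x, t). H x t) (y, 0) = p (f y)" using H0 by simp
  have "Hausdorff_space X" using X by (simp add: compactly_generated_def)
  from fibration_lift[OF p A this cg f Hc H0'] obtain G where G: "continuous_map (prod_topology ?W unit_interval) A G"
    "\<forall>y\<in>topspace ?W. \<forall>t\<in>{0..1}. p (G (y, t)) = H y t"
    by auto
  have "continuous_map ?W (prod_topology ?W unit_interval) (\<lambda>x. (x, 1))"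
    by (simp add: continuous_map_pairwise o_def)
  from continuous_map_compose[OF this G(1)]
  have "continuous_map ?W A (\<lambda>x. G (x, 1))" by (simp add: o_def)
  moreover have "\<forall>x\<in>W. p (G (x, 1)) = x" using G(2) H1 WX by auto
  ultimately show ?thesis unfolding has_local_section_def by blast
qed

section \<open>Deformations along the lines of the cone\<close>

text \<open>The point \<open>s\<close> stays fixed while the height \<open>u\<close> moves with time
  \<open>t\<close>. It is applied with \<open>1 - t * (1 - u)\<close>, which comes down from the
  apex, and with \<open>t * u\<close>, which rises from the base.\<close>

lemma continuous_map_prod_interval:
  assumes h: "continuous_on ({0..1} \<times> {0..1}) (case_prod h)"
    and I: "\<And>u t. \<lbrakk>u \<in> {0..1}; t \<in> {0..1}\<rbrakk> \<Longrightarrow> h u t \<in> {0..1::real}"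
  shows "continuous_map (prod_topology (prod_topology S unit_interval) unit_interval)
    (prod_topology S unit_interval) (\<lambda>((s, u), t). (s, h u t))"
proof -
  let ?T = "prod_topology (prod_topology S unit_interval) unit_interval"
  have s: "continuous_map ?T S (\<lambda>w. fst (fst w))"
    by (rule continuous_map_compose[OF continuous_map_fst continuous_map_fst, unfolded o_def])
  have "continuous_map ?T (prod_topology unit_interval unit_interval) (\<lambda>w. (snd (fst w), snd w))"
    unfolding continuous_map_pairwise o_def fst_conv snd_conv
    by (intro conjI continuous_map_snd
        continuous_map_compose[OF continuous_map_fst continuous_map_snd, unfolded o_def])
  moreover have "continuous_map (prod_topology unit_interval unit_interval) unit_interval (case_prod h)"
    using h I by (auto simp: continuous_map_in_subtopology)
  ultimately have "continuous_map ?T unit_interval (case_prod h \<circ> (\<lambda>w. (snd (fst w), snd w)))"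
    by (rule continuous_map_compose)
  with s show ?thesis
    by (simp add: continuous_map_pairwise o_def case_prod_unfold)
qed

text \<open>The homotopy sending \<open>[s, u]\<close> at time \<open>t\<close> to
  \<open>[s, 1 - t * (1 - u)]\<close> runs from the constant map at the apex to the identity of
  \<open>U\<close>. Its starting lift is constant at a point \<open>a\<close> over the apex, which
  exists by surjectivity of \<open>p\<close>.\<close>

lemma has_local_section_mapping_cone_apex:
  fixes S :: "'s topology" and K :: "'k topology"
  assumes X: "X = mapping_cone S K \<alpha>" "compactly_generated X"
    and p: "fibration A X p" "Hausdorff_space A" "p ` topspace A = topspace X"
    and S: "topspace S \<noteq> {}"
  obtains U where "openin X U" "has_local_section A X p U"
    "\<And>s t. \<lbrakk>s \<in> topspace S; 0 < t; t \<le> 1\<rbrakk> \<Longrightarrow> mapping_cone_proj S \<alpha> (Inr (s, t)) \<in> U"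
proof -
  let ?SI = "prod_topology S unit_interval"
  let ?q = "mapping_cone_proj S \<alpha>"
  have q: "quotient_map (disjoint_sum K ?SI) X ?q"
    unfolding X by (rule quotient_map_mapping_cone_proj)
  have im: "?q ` topspace (disjoint_sum K ?SI) = topspace X"
    using q by (simp add: quotient_map_def)
  \<comment> \<open>The cone coordinate respects both identifications: it is 0 on the base, as on
    \<open>K\<close>, and 1 on all of \<open>S \<times> 1\<close>.\<close>
  obtain height where height: "\<And>d. height (?q d) = case_sum (\<lambda>k. 0) snd d"
    by (rule mapping_cone_lift[of S snd "\<lambda>k. 0::real" \<alpha>]) auto
  define U where "U = {x \<in> topspace X. 0 < height x}"
  have qX: "?q (Inr (s, t)) \<in> topspace X" if "s \<in> topspace S" "t \<in> {0..1}" for s t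
    unfolding im[symmetric] by (rule imageI) (use that in auto)
  \<comment> \<open>The half-line is open in the real line, so the projection is first regarded as a
    map into the reals.\<close>
  have o1: "openin ?SI {z \<in> topspace ?SI. snd z \<in> {0<..}}"
    by (rule openin_continuous_map_preimage[OF continuous_map_into_fulltopology[OF continuous_map_snd]])
       simp
  have e1: "{z \<in> topspace ?SI. ?q (Inr z) \<in> U} = {z \<in> topspace ?SI. snd z \<in> {0<..}}"
    using qX by (auto simp: U_def height)
  have e2: "{k \<in> topspace K. mapping_cone_inclusion S \<alpha> k \<in> U} = {}"
    by (auto simp: U_def height simp flip: mapping_cone_proj_Inl)
  have sub: "U \<subseteq> topspace (mapping_cone S K \<alpha>)" by (auto simp: U_def X(1))
  have oU: "openin X U"
    unfolding X(1) openin_mapping_cone[OF sub] e1 e2 by (intro conjI openin_empty o1)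
  obtain s1 where s1: "s1 \<in> topspace S" using S by blast
  define c where "c = ?q (Inr (s1, 1))"
  have c: "?q (Inr (s, 1)) = c" if "s \<in> topspace S" for s
    unfolding c_def by (rule mapping_cone_proj_apex[OF that s1])
  have "c \<in> topspace X" using qX s1 by (simp add: c_def)
  then obtain a where a: "a \<in> topspace A" "p a = c" using p(3) by (metis imageE)
  define g where "g = (\<lambda>(s, u) t. ?q (Inr (s, 1 - t * (1 - u))))"
  have gc: "continuous_map (prod_topology ?SI unit_interval) X (\<lambda>(z, t). g z t)"
  proof -
    have "continuous_map (prod_topology ?SI unit_interval) ?SI
       (\<lambda>((s, u), t). (s, 1 - t * (1 - u)))"
      by (rule continuous_map_prod_interval)
         (auto simp: case_prod_unfold mult_le_one intro!: continuous_intros)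
    from continuous_map_compose[OF this continuous_map_mapping_cone_proj]
    show ?thesis unfolding X(1) by (simp add: o_def g_def case_prod_unfold)
  qed
  \<comment> \<open>No point of \<open>K\<close> is sent into \<open>U\<close>, so on that summand
    the stationary homotopy supplies continuous values without affecting the comparison with
    \<open>H\<close>.\<close>
  define F where "F = (\<lambda>(d, t). case_sum (\<lambda>k t. mapping_cone_inclusion S \<alpha> k) g d t)"
  have F: "continuous_map (prod_topology (disjoint_sum K ?SI) unit_interval) X F"
  proof (rule continuous_map_disjoint_sum_prod)
    show "continuous_map (prod_topology K unit_interval) X (\<lambda>(x, z). F (Inl x, z))"
      using continuous_map_compose[OF continuous_map_fst[of K unit_interval]
          continuous_map_mapping_cone_inclusion[of K S \<alpha>]]
      by (simp add: F_def X(1) o_def case_prod_unfold)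
    show "continuous_map (prod_topology ?SI unit_interval) X (\<lambda>(y, z). F (Inr y, z))"
      using gc by (simp add: F_def)
  qed
  \<comment> \<open>The homotopy does not descend to all of \<open>X\<close>, so its values outside \<open>U\<close> are junk.\<close>
  obtain H where H: "\<And>d. H (?q d) =
      case_sum (\<lambda>k. undefined) (\<lambda>z. if snd z = 0 then undefined else g z) d"
  proof (rule mapping_cone_lift[of S "\<lambda>z. if snd z = 0 then undefined else g z" "\<lambda>k. undefined" \<alpha>])
  qed (auto simp: g_def c)
  have Uq: "\<exists>s t. x = ?q (Inr (s, t)) \<and> s \<in> topspace S \<and> 0 < t \<and> t \<le> 1" if x: "x \<in> U" for x
  proof -
    have "x \<in> ?q ` topspace (disjoint_sum K ?SI)" using im x by (simp add: U_def)
    then obtain d where "d \<in> topspace (disjoint_sum K ?SI)" "x = ?q d" by blast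
    moreover from this obtain s t where "d = Inr (s, t)"
      using x by (cases d) (auto simp: U_def height)
    ultimately show ?thesis
      using x by (intro exI[of _ s] exI[of _ t]) (auto simp: U_def height)
  qed
  have "has_local_section A X p U"
  proof (rule has_local_section_homotopy[OF p(1,2) X(2) oU _ q F])
    show "continuous_map (subtopology X U) A (\<lambda>x. a)" using a by simp
    show "H (?q d) t = F (d, t)" if "?q d \<in> U" for d t
      using that by (auto simp: U_def height H F_def split: sum.splits)
    show "H x 0 = p a" if "x \<in> U" for x
      using Uq[OF that] by (auto simp: H g_def c a)
    show "H x 1 = x" if "x \<in> U" for x
      using Uq[OF that] by (auto simp: H g_def)
  qed
  moreover have "?q (Inr (s, t)) \<in> U" if "s \<in> topspace S" "0 < t" "t \<le> 1" for s t
    using that qX by (simp add: U_def height)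
  ultimately show ?thesis using that oU by blast
qed

text \<open>The homotopy from \<open>[s, u]\<close> at time 1 down to \<open>[s, 0]\<close> at time
  0 deforms \<open>W\<close> into the image of \<open>V\<close>. At time 0 it is the inclusion after
  the retraction \<open>r\<close>, and the \<open>A\<close>-component of the given section, composed
  with \<open>r\<close>, lifts it.\<close>

lemma has_local_section_mapping_cone_extend:
  fixes S :: "'s topology" and K :: "'k topology"
  assumes X: "X = mapping_cone S K \<alpha>" "compactly_generated X" and \<alpha>: "continuous_map S K \<alpha>"
    and p: "fibration A X p" "Hausdorff_space A"
    and V: "openin K V" "has_local_section (pullback_space K A (mapping_cone_inclusion S \<alpha>) p) K fst V"
  obtains W where "openin X W" "has_local_section A X p W"
    "\<And>k. k \<in> V \<Longrightarrow> mapping_cone_inclusion S \<alpha> k \<in> W"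
proof -
  let ?SI = "prod_topology S unit_interval"
  let ?q = "mapping_cone_proj S \<alpha>"
  let ?i = "mapping_cone_inclusion S \<alpha>"
  let ?D = "disjoint_sum K ?SI"
  have VK: "V \<subseteq> topspace K" using V(1) by (rule openin_subset)
  have q: "quotient_map ?D X ?q"
    unfolding X by (rule quotient_map_mapping_cone_proj)
  have im: "?q ` topspace ?D = topspace X"
    using q by (simp add: quotient_map_def)
  obtain height where height: "\<And>d. height (?q d) = case_sum (\<lambda>k. 0) snd d"
    by (rule mapping_cone_lift[of S snd "\<lambda>k. 0::real" \<alpha>]) auto
  \<comment> \<open>The retraction onto \<open>K\<close> has no continuous value at the apex.\<close>
  obtain r where r: "\<And>d. r (?q d) =
      case_sum (\<lambda>k. k) (\<lambda>z. if snd z = 1 then undefined else \<alpha> (fst z)) d"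
    by (rule mapping_cone_lift[of S "\<lambda>z. if snd z = 1 then undefined else \<alpha> (fst z)" "\<lambda>k. k" \<alpha>]) auto
  \<comment> \<open>The bound on the height removes the apex, so the default value of
    \<open>r\<close> never enters on \<open>W\<close>.\<close>
  define W where "W = {x \<in> topspace X. height x < 1 \<and> r x \<in> V}"
  have qX: "?q (Inr (s, t)) \<in> topspace X" if "s \<in> topspace S" "t \<in> {0..1}" for s t
    unfolding im[symmetric] by (rule imageI) (use that in auto)
  have iX: "?i k \<in> topspace X" if "k \<in> topspace K" for k
    unfolding im[symmetric] mapping_cone_proj_Inl[symmetric] by (rule imageI) (use that in auto)
  have \<alpha>': "continuous_map ?SI K (\<alpha> \<circ> fst)"
    by (rule continuous_map_compose[OF continuous_map_fst \<alpha>])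
  have o1: "openin ?SI {z \<in> topspace ?SI. snd z \<in> {..<1}}"
    by (rule openin_continuous_map_preimage[OF continuous_map_into_fulltopology[OF continuous_map_snd]])
       simp
  have o2: "openin ?SI {z \<in> topspace ?SI. (\<alpha> \<circ> fst) z \<in> V}"
    by (rule openin_continuous_map_preimage[OF \<alpha>' V(1)])
  have e1: "{z \<in> topspace ?SI. ?q (Inr z) \<in> W} =
      {z \<in> topspace ?SI. snd z \<in> {..<1}} \<inter> {z \<in> topspace ?SI. (\<alpha> \<circ> fst) z \<in> V}"
    using qX by (auto simp: W_def height r)
  have e2: "{k \<in> topspace K. ?i k \<in> W} = V"
    using VK iX by (auto simp: W_def height r simp flip: mapping_cone_proj_Inl)
  have sub: "W \<subseteq> topspace (mapping_cone S K \<alpha>)" by (auto simp: W_def X(1))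
  have oW: "openin X W"
    unfolding X(1) openin_mapping_cone[OF sub] e1 e2 using V(1) openin_Int[OF o1 o2] by blast
  have Wq: "(\<exists>k. x = ?i k \<and> k \<in> V) \<or>
      (\<exists>s t. x = ?q (Inr (s, t)) \<and> s \<in> topspace S \<and> \<alpha> s \<in> V \<and> 0 \<le> t \<and> t < 1)" if "x \<in> W" for x
  proof -
    have "x \<in> ?q ` topspace ?D" using im that by (simp add: W_def)
    then obtain d where "d \<in> topspace ?D" "x = ?q d" by blast
    then show ?thesis using that by (auto simp: W_def height r mapping_cone_proj_Inl)
  qed
  \<comment> \<open>Over \<open>W\<close>, the composite of \<open>r\<close> with the quotient map
    agrees with the map \<open>case_sum (\<lambda>k. k) (\<alpha> \<circ> fst)\<close>, which is
    continuous on all of \<open>?D\<close>.\<close>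
  have rc: "continuous_map (subtopology X W) (subtopology K V) r"
  proof (rule continuous_compose_quotient_map[OF quotient_map_restriction[OF q refl disjI1[OF oW]]])
    have "continuous_map ?D K (case_sum (\<lambda>k. k) (\<alpha> \<circ> fst))"
      using \<alpha>' by (intro continuous_map_case_sum) auto
    then have "continuous_map (subtopology ?D {d \<in> topspace ?D. ?q d \<in> W}) K (r \<circ> ?q)"
      by (rule continuous_map_eq[OF continuous_map_from_subtopology])
         (auto simp: W_def height r split: sum.splits)
    then show "continuous_map (subtopology ?D {d \<in> topspace ?D. ?q d \<in> W}) (subtopology K V) (r \<circ> ?q)"
      by (auto simp: continuous_map_in_subtopology W_def)
  qed
  obtain \<sigma> where \<sigma>: "continuous_map (subtopology K V) (pullback_space K A ?i p) \<sigma>"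
    "\<And>k. k \<in> V \<Longrightarrow> fst (\<sigma> k) = k"
    using V(2) unfolding has_local_section_def by blast
  \<comment> \<open>Passing to the \<open>k\<close>-ification only refines the topology, so the
    projection to \<open>A\<close> stays continuous.\<close>
  have snd: "continuous_map (pullback_space K A ?i p) A snd"
    unfolding pullback_space_def
    by (intro continuous_map_from_kification continuous_map_subtopology_snd)
  have \<sigma>p: "p (snd (\<sigma> k)) = ?i k" if "k \<in> V" for k
  proof -
    have "\<sigma> k \<in> topspace (pullback_space K A ?i p)"
      using \<sigma>(1) that VK by (auto simp: continuous_map_def Pi_iff)
    then show ?thesis using \<sigma>(2)[OF that] by (auto simp: pullback_space_def)
  qed
  define g where "g = (\<lambda>(s, u) t. ?q (Inr (s, t * u)))"
  have gc: "continuous_map (prod_topology ?SI unit_interval) X (\<lambda>(z, t). g z t)"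
  proof -
    have "continuous_map (prod_topology ?SI unit_interval) ?SI
       (\<lambda>((s, u), t). (s, t * u))"
      by (rule continuous_map_prod_interval)
         (auto simp: case_prod_unfold mult_le_one intro!: continuous_intros)
    from continuous_map_compose[OF this continuous_map_mapping_cone_proj]
    show ?thesis unfolding X(1) by (simp add: o_def g_def case_prod_unfold)
  qed
  define F where "F = (\<lambda>(d, t). case_sum (\<lambda>k t. ?i k) g d t)"
  have F: "continuous_map (prod_topology ?D unit_interval) X F"
  proof (rule continuous_map_disjoint_sum_prod)
    show "continuous_map (prod_topology K unit_interval) X (\<lambda>(x, z). F (Inl x, z))"
      using continuous_map_compose[OF continuous_map_fst[of K unit_interval]
          continuous_map_mapping_cone_inclusion[of K S \<alpha>]]
      by (simp add: F_def X(1) o_def case_prod_unfold)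
    show "continuous_map (prod_topology ?SI unit_interval) X (\<lambda>(y, z). F (Inr y, z))"
      using gc by (simp add: F_def)
  qed
  \<comment> \<open>On the base, \<open>g (s, 0) t\<close> is \<open>[s, 0]\<close> at every time
    and so matches the stationary homotopy on \<open>K\<close>. At the apex
    \<open>g (s, 1) t\<close> may depend on \<open>s\<close>, hence the default value there.\<close>
  obtain H where H: "\<And>d. H (?q d) =
      case_sum (\<lambda>k t. ?i k) (\<lambda>z. if snd z = 1 then undefined else g z) d"
    by (rule mapping_cone_lift[of S "\<lambda>z. if snd z = 1 then undefined else g z" "\<lambda>k t. ?i k" \<alpha>])
       (auto simp: g_def mapping_cone_proj_base)
  have "has_local_section A X p W"
  proof (rule has_local_section_homotopy[OF p(1,2) X(2) oW _ q F])
    show "continuous_map (subtopology X W) A (snd \<circ> \<sigma> \<circ> r)"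
      by (intro continuous_map_compose[OF rc] continuous_map_compose[OF \<sigma>(1) snd])
    show "H (?q d) t = F (d, t)" if "?q d \<in> W" for d t
      using that by (auto simp: W_def height H F_def split: sum.splits)
    have Hi: "H (?i k) t = ?i k" "r (?i k) = k" for k t
      using H[of "Inl k"] r[of "Inl k"] by (simp_all add: mapping_cone_proj_Inl)
    show "H x 0 = p ((snd \<circ> \<sigma> \<circ> r) x)" if "x \<in> W" for x
    proof -
      have "H x 0 = ?i (r x)"
        using Wq[OF that] by (auto simp: Hi H r g_def mapping_cone_proj_base)
      then show ?thesis using that \<sigma>p by (simp add: W_def)
    qed
    show "H x 1 = x" if "x \<in> W" for x
      using Wq[OF that] by (auto simp: Hi H g_def)
  qed
  moreover have "?i k \<in> W" if "k \<in> V" for k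
    using that VK iX by (auto simp: W_def height r simp flip: mapping_cone_proj_Inl)
  ultimately show ?thesis using that oW by blast
qed

section \<open>Sectional category\<close>

lemma secat_le:
  assumes "\<And>i. i \<le> n \<Longrightarrow> openin X (U i)" "\<And>i. i \<le> n \<Longrightarrow> has_local_section A X p (U i)"
    and "topspace X \<subseteq> (\<Union>i\<le>n. U i)"
  shows "secat A X p \<le> enat n"
proof -
  have "(\<Union>i\<le>n. U i) \<subseteq> topspace X" by (rule UN_least) (simp add: assms(1) openin_subset)
  then have "(\<Union>i\<le>n. U i) = topspace X" using assms(3) by (rule subset_antisym)
  moreover have "\<forall>i\<le>n. openin X (U i) \<and> has_local_section A X p (U i)" using assms(1,2) by simp
  ultimately show ?thesis unfolding secat_def by (intro Inf_lower) blast
qed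

text \<open>A nonempty set of extended naturals contains its infimum, so a finite sectional category
  comes with a cover that realises it.\<close>

lemma secat_cases:
  fixes X :: "'b topology"
  obtains "secat A X p = \<infinity>"
  | n U where "secat A X p = enat n"
    "\<And>i. i \<le> n \<Longrightarrow> openin X (U i)" "\<And>i. i \<le> n \<Longrightarrow> has_local_section A X p (U i)"
    "(\<Union>i\<le>n. U i) = topspace X"
proof -
  let ?N = "{enat n | n. \<exists>U :: nat \<Rightarrow> 'b set. (\<forall>i\<le>n. openin X (U i) \<and> has_local_section A X p (U i)) \<and>
            (\<Union>i\<le>n. U i) = topspace X}"
  show thesis
  proof (cases "?N = {}")
    case True
    then have "secat A X p = \<infinity>" unfolding secat_def by (simp add: Inf_enat_def)
    then show thesis using that(1) by blast
  next
    case False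
    then have "Inf ?N \<in> ?N" by (metis (no_types, lifting) Inf_enat_def LeastI_ex ex_in_conv)
    then show thesis using that(2) unfolding secat_def by blast
  qed
qed

section \<open>Pulling back covers with local sections\<close>

text \<open>The section is \<open>k \<mapsto> (k, s (\<phi> k))\<close>. Its continuity into the
  \<open>k\<close>-ified pullback follows from that into the plain subspace, because the preimage of
  \<open>U\<close>, being open in \<open>K\<close>, is a \<open>k\<close>-space.\<close>

lemma has_local_section_pullback:
  assumes K: "compactly_generated K" and \<phi>: "continuous_map K X \<phi>" and U: "openin X U"
    and sec: "has_local_section A X p U"
  shows "has_local_section (pullback_space K A \<phi> p) K fst {k \<in> topspace K. \<phi> k \<in> U}"
proof -
  let ?V = "{k \<in> topspace K. \<phi> k \<in> U}"
  obtain s where s: "continuous_map (subtopology X U) A s" "\<forall>x\<in>U. p (s x) = x"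
    using sec unfolding has_local_section_def by blast
  have "k_space (subtopology K ?V)"
    using K openin_continuous_map_preimage[OF \<phi> U] unfolding compactly_generated_def
    by (simp add: k_space_open_subtopology)
  moreover have "continuous_map (subtopology K ?V)
      (subtopology (prod_topology K A) {(k, a). \<phi> k = p a}) (\<lambda>k. (k, s (\<phi> k)))"
  proof -
    have "continuous_map (subtopology K ?V) (subtopology X U) \<phi>"
      using continuous_map_from_subtopology[OF \<phi>] by (auto simp: continuous_map_in_subtopology)
    from continuous_map_compose[OF this s(1)]
    show ?thesis using s(2) by (auto simp: continuous_map_in_subtopology continuous_map_pairwise o_def)
  qed
  ultimately have "continuous_map (subtopology K ?V) (pullback_space K A \<phi> p) (\<lambda>k. (k, s (\<phi> k)))"
    unfolding pullback_space_def by (simp add: continuous_map_into_kification)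
  then show ?thesis unfolding has_local_section_def by auto
qed

lemma secat_along_le:
  assumes K: "compactly_generated K" and \<phi>: "continuous_map K X \<phi>"
  shows "secat_along K \<phi> A p \<le> secat A X p"
proof (cases rule: secat_cases[of A X p])
  case (2 n U)
  have "secat (pullback_space K A \<phi> p) K fst \<le> enat n"
  proof (rule secat_le)
    show "topspace K \<subseteq> (\<Union>i\<le>n. {k \<in> topspace K. \<phi> k \<in> U i})"
    proof
      fix k assume k: "k \<in> topspace K"
      then have "\<phi> k \<in> (\<Union>i\<le>n. U i)" using 2(4) \<phi> by (auto simp: continuous_map_def)
      then show "k \<in> (\<Union>i\<le>n. {k \<in> topspace K. \<phi> k \<in> U i})" using k by blast
    qed
    show "openin K {k \<in> topspace K. \<phi> k \<in> U i}" if "i \<le> n" for i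
      by (rule openin_continuous_map_preimage[OF \<phi> 2(2)[OF that]])
    show "has_local_section (pullback_space K A \<phi> p) K fst {k \<in> topspace K. \<phi> k \<in> U i}"
      if "i \<le> n" for i
      by (rule has_local_section_pullback[OF K \<phi> 2(2)[OF that] 2(3)[OF that]])
  qed
  then show ?thesis using 2(1) by (simp add: secat_along_def)
qed simp

section \<open>Extending covers of \<open>K\<close> over the cone\<close>

text \<open>An optimal cover of \<open>K\<close> extends set by set to open sets of \<open>X\<close>
  with local sections, and these contain the image of \<open>K\<close>. The open set around the apex
  takes care of all \<open>[s, t]\<close> with \<open>t > 0\<close>.\<close>

lemma secat_mapping_cone_le:
  fixes S :: "'s topology" and K :: "'k topology"
  assumes X: "X = mapping_cone S K \<alpha>" "compactly_generated X" and \<alpha>: "continuous_map S K \<alpha>"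
    and p: "fibration A X p" "Hausdorff_space A" "p ` topspace A = topspace X"
    and S: "topspace S \<noteq> {}"
  shows "secat A X p \<le> secat_along K (mapping_cone_inclusion S \<alpha>) A p + 1"
proof -
  let ?q = "mapping_cone_proj S \<alpha>"
  let ?i = "mapping_cone_inclusion S \<alpha>"
  let ?P = "pullback_space K A ?i p"
  show ?thesis
  proof (cases rule: secat_cases[of ?P K fst])
    case (2 n V)
    obtain U where U: "openin X U" "has_local_section A X p U"
      "\<And>s t. \<lbrakk>s \<in> topspace S; 0 < t; t \<le> 1\<rbrakk> \<Longrightarrow> ?q (Inr (s, t)) \<in> U"
      using has_local_section_mapping_cone_apex[OF X p S] by blast
    have "\<forall>i. \<exists>W. i \<le> n \<longrightarrow> openin X W \<and> has_local_section A X p W \<and>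
        (\<forall>k\<in>V i. ?i k \<in> W)"
      using has_local_section_mapping_cone_extend[OF X \<alpha> p(1,2) 2(2,3)] by metis
    then obtain W where W: "\<And>i. i \<le> n \<Longrightarrow> openin X (W i)"
      "\<And>i. i \<le> n \<Longrightarrow> has_local_section A X p (W i)"
      "\<And>i k. \<lbrakk>i \<le> n; k \<in> V i\<rbrakk> \<Longrightarrow> ?i k \<in> W i"
      by metis
    have Wi: "\<exists>i\<le>n. ?i k \<in> W i" if "k \<in> topspace K" for k
      using that 2(4) W(3) by blast
    have "secat A X p \<le> enat (Suc n)"
    proof (rule secat_le)
      \<comment> \<open>The indices up to \<open>n\<close> carry the \<open>n + 1\<close> extended
        sets and the index \<open>Suc n\<close> carries the apex set, which accounts for the added
        1.\<close>
      let ?U = "\<lambda>i. if i \<le> n then W i else U"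
      show "topspace X \<subseteq> (\<Union>i\<le>Suc n. ?U i)"
      proof
        fix x assume "x \<in> topspace X"
        then have "x \<in> ?q ` topspace (disjoint_sum K (prod_topology S unit_interval))"
          using quotient_map_mapping_cone_proj[of K S \<alpha>] unfolding X(1) quotient_map_def by metis
        then obtain d where d: "d \<in> topspace (disjoint_sum K (prod_topology S unit_interval))" "x = ?q d"
          by blast
        have "(\<exists>i\<le>n. x \<in> W i) \<or> x \<in> U"
        proof (cases d)
          case (Inl k)
          then show ?thesis using d Wi by (auto simp: mapping_cone_proj_Inl)
        next
          case (Inr z)
          then obtain s t where z: "z = (s, t)" "s \<in> topspace S" "0 \<le> t" "t \<le> 1"
            using d(1) by (cases z) auto
          \<comment> \<open>The apex set misses the base, but \<open>[s, 0]\<close> is the image of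
            \<open>\<alpha> s\<close> and so lies in some \<open>W i\<close>.\<close>
          show ?thesis
          proof (cases "t = 0")
            case True
            have "\<alpha> s \<in> topspace K" using \<alpha> z(2) by (auto simp: continuous_map_def)
            then show ?thesis
              using Wi True z Inr d(2) mapping_cone_proj_base[of s S \<alpha>] by auto
          next
            case False
            then show ?thesis using U(3)[of s t] z Inr d(2) by simp
          qed
        qed
        then show "x \<in> (\<Union>i\<le>Suc n. ?U i)"
        proof
          assume "x \<in> U" then show ?thesis by (intro UN_I[of "Suc n"]) auto
        next
          assume "\<exists>i\<le>n. x \<in> W i"
          then obtain i where "i \<le> n" "x \<in> W i" by blast
          then show ?thesis by (intro UN_I[of i]) auto
        qed
      qed
    qed (use W U in auto)
    then show ?thesis using 2(1) by (simp add: secat_along_def eSuc_enat flip: eSuc_plus_1)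
  qed (simp add: secat_along_def)
qed

theorem proposition3p9:
  fixes S :: "'s topology" and K :: "'k topology" and A :: "'a topology"
    and X :: "('k + ('s \<times> real) set) set topology"
    and \<alpha> :: "'s \<Rightarrow> 'k" and p :: "'a \<Rightarrow> ('k + ('s \<times> real) set) set"
    and s0 :: 's and k0 :: 'k and a0 :: 'a
  assumes "pointed_space S s0" and "pointed_space K k0" and "pointed_space A a0"
    and "continuous_map S K \<alpha>" and "\<alpha> s0 = k0"
    and "X = mapping_cone S K \<alpha>" and "pointed_space X (mapping_cone_inclusion S \<alpha> k0)"
    and "fibration A X p" and "p a0 = mapping_cone_inclusion S \<alpha> k0"
    and "p ` topspace A = topspace X"
  shows "secat_along K (mapping_cone_inclusion S \<alpha>) A p \<le> secat A X p \<and>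
         secat A X p \<le> secat_along K (mapping_cone_inclusion S \<alpha>) A p + 1"
proof
  \<comment> \<open>The base point \<open>s0\<close> makes \<open>S\<close> nonempty, so that the
    cone has an apex.\<close>
  have cg: "compactly_generated K" "compactly_generated X" "Hausdorff_space A" "topspace S \<noteq> {}"
    using assms(1-3,7) by (auto simp: pointed_space_def compactly_generated_def well_pointed_def)
  show "secat_along K (mapping_cone_inclusion S \<alpha>) A p \<le> secat A X p"
    using secat_along_le[OF cg(1)] continuous_map_mapping_cone_inclusion assms(6) by metis
  show "secat A X p \<le> secat_along K (mapping_cone_inclusion S \<alpha>) A p + 1"
    by (rule secat_mapping_cone_le[OF assms(6) cg(2) assms(4,8) cg(3) assms(10) cg(4)])
qed

end
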